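(* For all integers $n\geq 4$ and $p\geq 0$, $$\mathcal{A}(H_{3,n-3}\cup pK_1)<\mathcal{A}(P_{n+1}\cup pK_1).$$
   Context: Graphs are finite and simple. For a graph $G$ and an integer $k$, $S(G,k)$ is the number of partitions of the vertex set of $G$ into exactly $k$ nonempty stable sets (sets of pairwise non-adjacent vertices). Put $\mathcal{B}(G)=\sum_{k}S(G,k)$, $\mathcal{T}(G)=\sum_{k}k\,S(G,k)$ and $\mathcal{A}(G)=\mathcal{T}(G)/\mathcal{B}(G)$ (the average number of colors in the non-equivalent colorings of $G$). $P_n$ and $C_n$ are the path and the cycle on $n$ vertices. For $m\geq 3$ and $r\geq 0$, $H_{m,r}$ is the graph on $m+r$ vertices obtained from the disjoint union of $C_m$ and $P_r$ by linking (with an edge) one extremity of $P_r$ to one vertex of $C_m$; $H_{m,0}=C_m$. $G\cup pK_1$ is the graph obtained from $G$ by adding $p$ isolated vertices. *)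

theory Defs
  imports Complex_Main "HOL-Library.Disjoint_Sets" "Graph_Theory.Pair_Digraph"
begin

text \<open>
  A finite simple graph is a \<^locale>\<open>pair_graph\<close>: finite vertex set, loop-free and symmetric
  set of arcs, so that the edge joining u and v is the pair of arcs (u,v) and (v,u).
\<close>

subsection \<open>Partitions into stable sets\<close>

definition stable :: "'a pair_pre_digraph \<Rightarrow> 'a set \<Rightarrow> bool" where
  "stable G A \<longleftrightarrow> A \<subseteq> pverts G \<and> (\<forall>u\<in>A. \<forall>v\<in>A. (u, v) \<notin> parcs G)"

definition stable_partitions :: "'a pair_pre_digraph \<Rightarrow> nat \<Rightarrow> 'a set set set" where
  "stable_partitions G k =
     {P. partition_on (pverts G) P \<and> (\<forall>A\<in>P. stable G A) \<and> card P = k}"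

definition graph_stirling :: "'a pair_pre_digraph \<Rightarrow> nat \<Rightarrow> nat" where
  "graph_stirling G k = card (stable_partitions G k)"

text \<open>
  For finite graphs the sums over all k may be cut off at the number of vertices.
\<close>

lemma graph_stirling_eq_0:
  assumes "finite (pverts G)" "card (pverts G) < k"
  shows "graph_stirling G k = 0"
proof -
  have "card P \<le> card (pverts G)" if P: "partition_on (pverts G) P" for P
  proof -
    have fin: "finite P" using assms(1) P by (rule finite_elements)
    have U: "\<Union>P = pverts G" using P by (simp add: partition_on_def)
    have fA: "finite A" if "A \<in> P" for A
      using assms(1) U that by (metis Sup_upper rev_finite_subset)
    have "card P = (\<Sum>A\<in>P. 1)" by simp
    also have "\<dots> \<le> (\<Sum>A\<in>P. card A)"
    proof (rule sum_mono)
      fix A assume "A \<in> P"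
      then have "A \<noteq> {}" "finite A" using P fA by (auto simp: partition_on_def)
      then show "1 \<le> card A" by (simp add: Suc_le_eq card_gt_0_iff)
    qed
    also have "\<dots> = card (\<Union>P)"
      using P fA by (intro card_Union_disjoint[symmetric]) (auto simp: partition_on_def)
    finally show ?thesis using U by simp
  qed
  then have "stable_partitions G k = {}"
    using assms(2) by (fastforce simp: stable_partitions_def)
  then show ?thesis by (simp add: graph_stirling_def)
qed

definition graph_bell :: "'a pair_pre_digraph \<Rightarrow> nat" where
  "graph_bell G = (\<Sum>k\<le>card (pverts G). graph_stirling G k)"

definition total_colors :: "'a pair_pre_digraph \<Rightarrow> nat" where
  "total_colors G = (\<Sum>k\<le>card (pverts G). k * graph_stirling G k)"

definition avg_colors :: "'a pair_pre_digraph \<Rightarrow> real" where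
  "avg_colors G = real (total_colors G) / real (graph_bell G)"

subsection \<open>The graphs involved\<close>

definition disjoint_union ::
    "'a pair_pre_digraph \<Rightarrow> 'b pair_pre_digraph \<Rightarrow> ('a + 'b) pair_pre_digraph" where
  "disjoint_union G H =
     \<lparr> pverts = pverts G <+> pverts H,
       parcs = map_prod Inl Inl ` parcs G \<union> map_prod Inr Inr ` parcs H \<rparr>"

definition add_edge :: "'a \<Rightarrow> 'a \<Rightarrow> 'a pair_pre_digraph \<Rightarrow> 'a pair_pre_digraph" where
  "add_edge u v G = \<lparr> pverts = pverts G, parcs = parcs G \<union> {(u, v), (v, u)} \<rparr>"

definition edgeless_graph :: "nat \<Rightarrow> nat pair_pre_digraph" where
  "edgeless_graph p = \<lparr> pverts = {..<p}, parcs = {} \<rparr>"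

definition add_isolated :: "'a pair_pre_digraph \<Rightarrow> nat \<Rightarrow> ('a + nat) pair_pre_digraph" where
  "add_isolated G p = disjoint_union G (edgeless_graph p)"

definition path_graph :: "nat \<Rightarrow> nat pair_pre_digraph" where
  "path_graph n =
     \<lparr> pverts = {..<n}, parcs = {(i, j). i < n \<and> j < n \<and> (j = Suc i \<or> i = Suc j)} \<rparr>"

text \<open>Only meaningful for \<open>n \<ge> 3\<close>.\<close>

definition cycle_graph :: "nat \<Rightarrow> nat pair_pre_digraph" where
  "cycle_graph n =
     \<lparr> pverts = {..<n},
       parcs = {(i, j). i < n \<and> j < n \<and> (j = Suc i mod n \<or> i = Suc j mod n)} \<rparr>"

text \<open>
  \<open>H\<^bsub>m,r\<^esub>\<close>: the linking edge joins vertex 0 of the cycle to vertex 0 of the path, which is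
  one of its extremities. For \<open>r = 0\<close> the path is empty and no edge is added.
\<close>

definition H_graph :: "nat \<Rightarrow> nat \<Rightarrow> (nat + nat) pair_pre_digraph" where
  "H_graph m r =
     (let G = disjoint_union (cycle_graph m) (path_graph r)
      in if r = 0 then G else add_edge (Inl 0) (Inr 0) G)"

lemma pair_graphI:
  assumes "finite (pverts G)" "parcs G \<subseteq> pverts G \<times> pverts G"
    "\<And>u v. (u, v) \<in> parcs G \<Longrightarrow> (v, u) \<in> parcs G" "\<And>u. (u, u) \<notin> parcs G"
  shows "pair_graph G"
proof
  show "finite (parcs G)" using assms(1,2) by (meson finite_SigmaI finite_subset)
  show "symmetric (with_proj G)"
    using assms(3) by (auto simp: symmetric_def arcs_ends_def arc_to_ends_def sym_def)
qed (use assms in auto)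

lemma pair_graphD:
  assumes "pair_graph G"
  shows "finite (pverts G)" "parcs G \<subseteq> pverts G \<times> pverts G"
    "\<And>u v. (u, v) \<in> parcs G \<Longrightarrow> (v, u) \<in> parcs G" "\<And>u. (u, u) \<notin> parcs G"
proof -
  interpret pair_graph G by fact
  show "finite (pverts G)" by simp
  show "parcs G \<subseteq> pverts G \<times> pverts G"
    using arc_fst_in_verts arc_snd_in_verts by fastforce
  show "(v, u) \<in> parcs G" if "(u, v) \<in> parcs G" for u v
    using pair_sym_arcs that
    by (auto simp: symmetric_def arcs_ends_def arc_to_ends_def sym_def)
  show "(u, u) \<notin> parcs G" for u using pair_no_loops by force
qed

lemma pair_graph_disjoint_union:
  assumes "pair_graph G" "pair_graph H"
  shows "pair_graph (disjoint_union G H)"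
  using pair_graphD[OF assms(1)] pair_graphD[OF assms(2)]
  by (intro pair_graphI) (auto simp: disjoint_union_def)

lemma pair_graph_add_edge:
  assumes "pair_graph G" "u \<in> pverts G" "v \<in> pverts G" "u \<noteq> v"
  shows "pair_graph (add_edge u v G)"
  using pair_graphD[OF assms(1)] assms(2-)
  by (intro pair_graphI) (auto simp: add_edge_def)

lemma pair_graph_path_graph: "pair_graph (path_graph n)"
  by (intro pair_graphI) (auto simp: path_graph_def)

lemma pair_graph_cycle_graph:
  assumes "n \<ge> 3" shows "pair_graph (cycle_graph n)"
  using assms by (intro pair_graphI) (auto simp: cycle_graph_def mod_Suc split: if_splits)

lemma pair_graph_H_graph:
  assumes "m \<ge> 3" shows "pair_graph (H_graph m r)"
proof -
  have G: "pair_graph (disjoint_union (cycle_graph m) (path_graph r))"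
    by (simp add: assms pair_graph_disjoint_union pair_graph_cycle_graph pair_graph_path_graph)
  show ?thesis
  proof (cases "r = 0")
    case False
    have "pair_graph (add_edge (Inl 0) (Inr 0) (disjoint_union (cycle_graph m) (path_graph r)))"
      using G False assms
      by (intro pair_graph_add_edge)
         (auto simp: disjoint_union_def cycle_graph_def path_graph_def)
    with False show ?thesis by (simp add: H_graph_def)
  qed (use G in \<open>simp add: H_graph_def\<close>)
qed

lemma pair_graph_add_isolated:
  assumes "pair_graph G" shows "pair_graph (add_isolated G p)"
  unfolding add_isolated_def
  by (intro pair_graph_disjoint_union assms pair_graphI) (auto simp: edgeless_graph_def)

end

theory Submission
  imports Defs
begin

text \<open>
  Counting the proper colourings with \<open>x\<close> colours by their colour classes gives
  \<open>c\<^sub>G(x) = \<Sum>\<^sub>k S(G,k) x(x - 1)\<dots>(x - k + 1)\<close>. As in Dobinski's formula,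
  \<open>\<Sum>\<^sub>x c\<^sub>G(x)/x! = e B(G)\<close> and \<open>\<Sum>\<^sub>x (x - 1) c\<^sub>G(x)/x! = e T(G)\<close>. The chromatic
  polynomials are \<open>x\<^sup>p\<^sup>+\<^sup>1 (x - 1)\<^sup>n\<close> for the path and
  \<open>x\<^sup>p\<^sup>+\<^sup>1 (x - 1)\<^sup>n\<^sup>-\<^sup>2 (x - 2)\<close> for the triangle with a tail, so with
  \<open>a\<^sub>m = \<Sum>\<^sub>k (k + 1)\<^sup>p k\<^sup>m / k!\<close> and \<open>m = n - 2\<close> the claim is
  \<open>a\<^sub>m\<^sub>+\<^sub>2 (a\<^sub>m\<^sub>+\<^sub>2 - a\<^sub>m\<^sub>+\<^sub>1) < a\<^sub>m\<^sub>+\<^sub>3 (a\<^sub>m\<^sub>+\<^sub>1 - a\<^sub>m)\<close>.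
  Symmetrized, the difference is half the double sum over \<open>i, j\<close> of
  \<open>w\<^sub>i w\<^sub>j (ij)\<^sup>m (i - j)\<^sup>2 (ij - i - j)\<close> with \<open>w\<^sub>k = (k + 1)\<^sup>p / k!\<close>.
  Only the terms in which \<open>i\<close> or \<open>j\<close> is 1 are negative. For \<open>j \<ge> 4\<close> the pair \<open>(1, j)\<close>
  is outweighed by \<open>(2, j)\<close>, while \<open>(1, 2)\<close> and \<open>(1, 3)\<close> are compensated by \<open>(2, 3)\<close>
  and \<open>(3, 4)\<close>.
\<close>

subsection \<open>Counting proper colourings\<close>

definition proper_colorings :: "'a pair_pre_digraph \<Rightarrow> nat \<Rightarrow> ('a \<Rightarrow> nat) set" where
  "proper_colorings G x =
     {f \<in> pverts G \<rightarrow>\<^sub>E {..<x}. \<forall>(u, v) \<in> parcs G. f u \<noteq> f v}"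

lemma finite_proper_colorings:
  assumes "finite (pverts G)"
  shows "finite (proper_colorings G x)"
proof -
  have "finite (pverts G \<rightarrow>\<^sub>E {..<x})" using assms by (intro finite_PiE) auto
  then show ?thesis by (rule rev_finite_subset) (auto simp: proper_colorings_def)
qed

text \<open>The neighbours \<open>N\<close> of the new vertex \<open>v\<close> form a clique, so a
  proper colouring of \<open>G\<close> uses \<open>card N\<close> distinct colours on them, and
  exactly these are forbidden at \<open>v\<close>. Both graph families are built by such
  steps.\<close>

lemma card_proper_colorings_simplicial:
  assumes fin: "finite (pverts G)" and arcs: "parcs G \<subseteq> pverts G \<times> pverts G"
    and v: "v \<notin> pverts G" and N: "N \<subseteq> pverts G"
    and clique: "\<And>u w. u \<in> N \<Longrightarrow> w \<in> N \<Longrightarrow> u \<noteq> w \<Longrightarrow> (u, w) \<in> parcs G"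
    and verts': "pverts G' = insert v (pverts G)"
    and arcs': "parcs G' = parcs G \<union> N \<times> {v} \<union> {v} \<times> N"
  shows "card (proper_colorings G' x) = card (proper_colorings G x) * (x - card N)"
proof -
  let ?S = "SIGMA f : proper_colorings G x. {..<x} - f ` N"
  have neq: "\<And>u. u \<in> N \<Longrightarrow> u \<noteq> v" "\<And>u w. (u, w) \<in> parcs G \<Longrightarrow> u \<noteq> v \<and> w \<noteq> v"
    using N v arcs by auto
  have "bij_betw (\<lambda>(f, c). f(v := c)) ?S (proper_colorings G' x)"
  \<comment> \<open>Colourings are extensional, so forgetting the colour of \<open>v\<close> means
    resetting it to \<open>undefined\<close>.\<close>
  proof (rule bij_betw_byWitness[where f' = "\<lambda>f. (f(v := undefined), f v)"])
    show "\<forall>a\<in>?S. (\<lambda>f. (f(v := undefined), f v)) ((\<lambda>(f, c). f(v := c)) a) = a"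
      using v by (auto simp: proper_colorings_def fun_eq_iff PiE_def extensional_def)
    show "\<forall>f\<in>proper_colorings G' x. (\<lambda>(f, c). f(v := c)) (f(v := undefined), f v) = f"
      by auto
    show "(\<lambda>(f, c). f(v := c)) ` ?S \<subseteq> proper_colorings G' x"
      using neq by (fastforce simp: proper_colorings_def verts' arcs' PiE_def extensional_def)
    show "(\<lambda>f. (f(v := undefined), f v)) ` proper_colorings G' x \<subseteq> ?S"
    proof (rule image_subsetI)
      fix f assume f: "f \<in> proper_colorings G' x"
      have "f v \<notin> (f(v := undefined)) ` N"
        using f neq(1) by (fastforce simp: proper_colorings_def arcs')
      moreover have "f(v := undefined) \<in> proper_colorings G x"
        using f neq(2) v
        by (fastforce simp: proper_colorings_def verts' arcs' PiE_def extensional_def Pi_def)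
      moreover have "f v < x"
        using f by (auto simp: proper_colorings_def verts')
      ultimately show "(f(v := undefined), f v) \<in> ?S" by blast
    qed
  qed
  then have "card (proper_colorings G' x) = card ?S"
    by (simp add: bij_betw_same_card)
  also have "\<dots> = (\<Sum>f\<in>proper_colorings G x. card ({..<x} - f ` N))"
    by (rule card_SigmaI) (use fin finite_proper_colorings in auto)
  also have "\<dots> = (\<Sum>f\<in>proper_colorings G x. x - card N)"
  proof (rule sum.cong)
    fix f assume f: "f \<in> proper_colorings G x"
    have "inj_on f N"
      using f clique by (fastforce simp: proper_colorings_def inj_on_def)
    moreover have "f ` N \<subseteq> {..<x}"
      using f N by (auto simp: proper_colorings_def)
    ultimately show "card ({..<x} - f ` N) = x - card N"
      using fin N by (simp add: card_Diff_subset card_image finite_subset)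
  qed auto
  finally show ?thesis by simp
qed

lemma card_proper_colorings_disjoint_union:
  "card (proper_colorings (disjoint_union G H) x)
     = card (proper_colorings G x) * card (proper_colorings H x)"
proof -
  let ?U = "proper_colorings (disjoint_union G H) x"
  let ?P = "proper_colorings G x \<times> proper_colorings H x"
  have "bij_betw (\<lambda>(f, g). case_sum f g) ?P ?U"
  proof (rule bij_betw_byWitness[where f' = "\<lambda>h. (h \<circ> Inl, h \<circ> Inr)"])
    show "\<forall>a\<in>?P. (\<lambda>h. (h \<circ> Inl, h \<circ> Inr)) ((\<lambda>(f, g). case_sum f g) a) = a"
      by (auto simp: fun_eq_iff)
    show "\<forall>h\<in>?U. (\<lambda>(f, g). case_sum f g) (h \<circ> Inl, h \<circ> Inr) = h"
      by (auto simp: fun_eq_iff split: sum.split)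
    show "(\<lambda>(f, g). case_sum f g) ` ?P \<subseteq> ?U"
      by (fastforce simp: proper_colorings_def disjoint_union_def PiE_def extensional_def Pi_def
          split: sum.split)
    show "(\<lambda>h. (h \<circ> Inl, h \<circ> Inr)) ` ?U \<subseteq> ?P"
      by (fastforce simp: proper_colorings_def disjoint_union_def PiE_def extensional_def Pi_def)
  qed
  then have "card ?U = card ?P" by (simp add: bij_betw_same_card)
  then show ?thesis by (simp add: card_cartesian_product)
qed

lemma card_proper_colorings_edgeless_graph:
  "card (proper_colorings (edgeless_graph p) x) = x ^ p"
  by (simp add: proper_colorings_def edgeless_graph_def card_PiE)

lemma card_proper_colorings_add_isolated:
  "card (proper_colorings (add_isolated G p) x) = card (proper_colorings G x) * x ^ p"
  by (simp add: add_isolated_def card_proper_colorings_disjoint_union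
      card_proper_colorings_edgeless_graph)

section \<open>Chromatic polynomials of the path and of the triangle with a tail\<close>

lemma card_proper_colorings_path_graph:
  "card (proper_colorings (path_graph (Suc n)) x) = x * (x - 1) ^ n"
proof (induction n)
  case 0
  have "path_graph (Suc 0) = edgeless_graph 1"
    by (auto simp: path_graph_def edgeless_graph_def)
  then show ?case by (simp add: card_proper_colorings_edgeless_graph)
next
  case (Suc n)
  have "card (proper_colorings (path_graph (Suc (Suc n))) x)
      = card (proper_colorings (path_graph (Suc n)) x) * (x - card {n})"
    by (rule card_proper_colorings_simplicial[where v = "Suc n"])
       (auto simp: path_graph_def lessThan_Suc)
  then show ?case by (simp add: Suc.IH)
qed

lemma card_proper_colorings_cycle_graph_3:
  "card (proper_colorings (cycle_graph 3) x) = x * (x - 1) * (x - 2)"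
proof -
  have less_3: "i < 3 \<longleftrightarrow> i = 0 \<or> i = 1 \<or> i = 2" for i :: nat by auto
  have less_2: "i < Suc 1 \<longleftrightarrow> i = 0 \<or> i = 1" for i :: nat by auto
  have C: "parcs (cycle_graph 3) = {(0, 1), (1, 0), (1, 2), (2, 1), (0, 2), (2, 0)}"
    unfolding cycle_graph_def less_3 by auto
  have P: "parcs (path_graph (Suc 1)) = {(0, 1), (1, 0)}"
    unfolding path_graph_def less_2 by auto
  \<comment> \<open>The triangle is the edge between 0 and 1 together with a vertex 2 joined to both
    ends.\<close>
  have "card (proper_colorings (cycle_graph 3) x)
      = card (proper_colorings (path_graph (Suc 1)) x) * (x - card {0, 1 :: nat})"
    by (rule card_proper_colorings_simplicial[where v = 2], unfold C P)
       (auto simp: path_graph_def cycle_graph_def less_3)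
  then show ?thesis
    unfolding card_proper_colorings_path_graph by (simp add: numeral_2_eq_2)
qed

lemma card_proper_colorings_H_graph_3:
  "card (proper_colorings (H_graph 3 r) x) = x * (x - 1) * (x - 2) * (x - 1) ^ r"
proof (induction r)
  case 0
  have "path_graph 0 = edgeless_graph 0"
    by (simp add: path_graph_def edgeless_graph_def)
  then show ?case
    by (simp add: H_graph_def card_proper_colorings_disjoint_union
        card_proper_colorings_edgeless_graph card_proper_colorings_cycle_graph_3)
next
  case (Suc r)
  have G: "pair_graph (H_graph 3 r)" by (simp add: pair_graph_H_graph)
  \<comment> \<open>The new vertex \<open>Inr r\<close> hangs from the end of the tail, or from the
    cycle vertex \<open>Inl 0\<close> while the tail is empty.\<close>
  have "card (proper_colorings (H_graph 3 (Suc r)) x)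
      = card (proper_colorings (H_graph 3 r) x)
        * (x - card {if r = 0 then Inl 0 else Inr (r - 1) :: nat + nat})"
  proof (rule card_proper_colorings_simplicial[where v = "Inr r"])
    show "parcs (H_graph 3 (Suc r)) = parcs (H_graph 3 r)
        \<union> {if r = 0 then Inl 0 else Inr (r - 1)} \<times> {Inr r}
        \<union> {Inr r} \<times> {if r = 0 then Inl 0 else Inr (r - 1)}"
    proof (cases r)
      case 0 then show ?thesis
        by (auto simp: H_graph_def add_edge_def disjoint_union_def path_graph_def)
    next
      case (Suc m)
      have "parcs (path_graph (Suc r)) = parcs (path_graph r) \<union> {(m, r), (r, m)}"
        using Suc by (auto simp: path_graph_def)
      then show ?thesis using Suc
        by (auto simp: H_graph_def add_edge_def disjoint_union_def)
    qed
  qed (use pair_graphD[OF G] in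
        \<open>auto simp: H_graph_def add_edge_def disjoint_union_def path_graph_def cycle_graph_def Let_def
           split: if_splits\<close>)
  then show ?case by (simp add: Suc.IH)
qed

subsection \<open>Colour classes and Dobinski's formula\<close>

definition color_classes :: "'a set \<Rightarrow> ('a \<Rightarrow> 'b) \<Rightarrow> 'a set set" where
  "color_classes V f = (\<lambda>c. {v \<in> V. f v = c}) ` f ` V"

lemma partition_on_color_classes: "partition_on V (color_classes V f)"
  by (rule partition_onI) (auto simp: color_classes_def disjnt_def)

lemma proper_colorings_eq_stable:
  assumes "parcs G \<subseteq> pverts G \<times> pverts G"
  shows "proper_colorings G x
     = {f \<in> pverts G \<rightarrow>\<^sub>E {..<x}. \<forall>A\<in>color_classes (pverts G) f. stable G A}"
proof -
  have "(\<forall>A\<in>color_classes (pverts G) f. stable G A) \<longleftrightarrow> (\<forall>(u, v)\<in>parcs G. f u \<noteq> f v)"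
    for f :: "'a \<Rightarrow> nat"
    using assms by (fastforce simp: color_classes_def stable_def)
  then show ?thesis by (simp add: proper_colorings_def)
qed

text \<open>Here \<open>g\<close> gives each block its common colour. This turns colourings with
  prescribed classes into injections from the blocks to the colours, which are easy to
  count.\<close>

lemma color_classes_eq_iff:
  assumes P: "partition_on V P"
  shows "color_classes V f = P
     \<longleftrightarrow> (\<exists>g. inj_on g P \<and> (\<forall>A\<in>P. \<forall>v\<in>A. f v = g A))"
proof
  assume P_def: "color_classes V f = P"
  define g where "g A = the_elem (f ` A)" for A
  have image: "f ` A = {f v}" if "A \<in> P" "v \<in> A" for A v
    using that unfolding P_def[symmetric] color_classes_def by auto
  have g: "g A = f v" if "A \<in> P" "v \<in> A" for A v
    using image[OF that] by (simp add: g_def)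
  have "inj_on g P"
  proof (rule inj_onI)
    fix A B assume AB: "A \<in> P" "B \<in> P" "g A = g B"
    then obtain a b where "A = {v \<in> V. f v = f a}" "a \<in> V" "B = {v \<in> V. f v = f b}" "b \<in> V"
      unfolding P_def[symmetric] color_classes_def by auto
    then show "A = B" using g[of A a] g[of B b] AB by simp
  qed
  then show "\<exists>g. inj_on g P \<and> (\<forall>A\<in>P. \<forall>v\<in>A. f v = g A)" using g by metis
next
  assume "\<exists>g. inj_on g P \<and> (\<forall>A\<in>P. \<forall>v\<in>A. f v = g A)"
  then obtain g where inj: "inj_on g P" and g: "\<And>A v. A \<in> P \<Longrightarrow> v \<in> A \<Longrightarrow> f v = g A" by blast
  have U: "\<Union>P = V" and ne: "{} \<notin> P" using P by (auto simp: partition_on_def)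
  have fibre: "{v \<in> V. f v = g A} = A" if "A \<in> P" for A
    using that U g inj by (auto dest: inj_onD)
  have "f ` V = g ` P"
  proof
    show "f ` V \<subseteq> g ` P" using U g by auto
    show "g ` P \<subseteq> f ` V"
    proof (rule image_subsetI)
      fix A assume A: "A \<in> P"
      then obtain v where "v \<in> A" using ne by (metis equals0I)
      then have "v \<in> V" "g A = f v" using A U g by auto
      then show "g A \<in> f ` V" by simp
    qed
  qed
  then have "color_classes V f = (\<lambda>A. {v \<in> V. f v = g A}) ` P"
    by (simp add: color_classes_def image_image)
  then show "color_classes V f = P" using fibre by simp
qed

lemma card_color_classes_eq:
  assumes P: "partition_on V P"
  shows "card {f \<in> V \<rightarrow>\<^sub>E {..<x}. color_classes V f = P}
           = card {g \<in> P \<rightarrow>\<^sub>E {..<x}. inj_on g P}"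
proof -
  have U: "\<Union>P = V" and ne: "{} \<notin> P" and disj: "disjoint P"
    using P by (auto simp: partition_on_def)
  \<comment> \<open>The bijection colours \<open>v\<close> by the colour of its block. Disjointness
    makes the block unique; nonempty blocks let \<open>g\<close> be recovered from the
    colouring.\<close>
  define block where "block v = (THE A. A \<in> P \<and> v \<in> A)" for v
  have block: "block v = A" if "A \<in> P" "v \<in> A" for v A
    unfolding block_def
    by (rule the_equality) (use that disj in \<open>auto simp: disjoint_def\<close>)
  let ?I = "{g \<in> P \<rightarrow>\<^sub>E {..<x}. inj_on g P}"
  let ?F = "{f \<in> V \<rightarrow>\<^sub>E {..<x}. color_classes V f = P}"
  have "bij_betw (\<lambda>g. \<lambda>v\<in>V. g (block v)) ?I ?F"
  proof (rule bij_betwI')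
    fix g h assume gh: "g \<in> ?I" "h \<in> ?I"
    show "((\<lambda>v\<in>V. g (block v)) = (\<lambda>v\<in>V. h (block v))) \<longleftrightarrow> g = h"
    proof
      assume eq: "(\<lambda>v\<in>V. g (block v)) = (\<lambda>v\<in>V. h (block v))"
      show "g = h"
      proof (rule PiE_ext)
        show "g \<in> P \<rightarrow>\<^sub>E {..<x}" "h \<in> P \<rightarrow>\<^sub>E {..<x}" using gh by auto
        fix A assume A: "A \<in> P"
        then obtain v where v: "v \<in> A" using ne by (metis equals0I)
        then have "v \<in> V" using A U by auto
        then show "g A = h A" using fun_cong[OF eq, of v] block[OF A v] by simp
      qed
    qed simp
  next
    fix g assume g: "g \<in> ?I"
    let ?f = "\<lambda>v\<in>V. g (block v)"
    have "?f \<in> V \<rightarrow>\<^sub>E {..<x}"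
    proof (rule restrict_PiE[THEN iffD2], intro PiE_I Pi_I)
      fix v assume "v \<in> V"
      then obtain A where "A \<in> P" "v \<in> A" using U by auto
      then show "g (block v) \<in> {..<x}" using g block by auto
    qed
    moreover have "color_classes V ?f = P"
      unfolding color_classes_eq_iff[OF P]
      using g U block by (intro exI[of _ g]) auto
    ultimately show "?f \<in> ?F" by simp
  next
    fix f assume f: "f \<in> ?F"
    then obtain g where g: "inj_on g P" "\<And>A v. A \<in> P \<Longrightarrow> v \<in> A \<Longrightarrow> f v = g A"
      using color_classes_eq_iff[OF P, of f] by auto
    have "restrict g P \<in> ?I"
    proof -
      have "g A < x" if A: "A \<in> P" for A
      proof -
        obtain v where v: "v \<in> A" using A ne by (metis equals0I)
        then have "v \<in> V" using A U by auto
        then have "f v < x" using f by auto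
        then show ?thesis using g(2)[OF A v] by simp
      qed
      then show ?thesis using g(1) by auto
    qed
    moreover have "f = (\<lambda>v\<in>V. restrict g P (block v))"
    proof
      fix v show "f v = (\<lambda>v\<in>V. restrict g P (block v)) v"
      proof (cases "v \<in> V")
        case True
        then obtain A where "A \<in> P" "v \<in> A" using U by auto
        then show ?thesis using True g(2) block by simp
      next
        case False
        then show ?thesis using f by (auto simp: PiE_def extensional_def)
      qed
    qed
    ultimately show "\<exists>g\<in>?I. f = (\<lambda>v\<in>V. g (block v))" by blast
  qed
  then show ?thesis by (simp add: bij_betw_same_card)
qed

text \<open>The falling factorial. Truncated subtraction is harmless: for \<open>x < k\<close> the
  factor with \<open>i = x\<close> is already 0.\<close>

definition falling :: "nat \<Rightarrow> nat \<Rightarrow> nat" where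
  "falling x k = (\<Prod>i<k. x - i)"

lemma falling_eq_0: "x < k \<Longrightarrow> falling x k = 0"
  by (auto simp: falling_def)

text \<open>Division-free form of the cancellation that reduces the Dobinski series to the
  exponential series.\<close>

lemma falling_add_mult_fact: "falling (x + k) k * fact x = fact (x + k)"
proof (induction k)
  case (Suc k)
  have "falling (x + Suc k) (Suc k) = (x + Suc k) * falling (x + k) k"
    unfolding falling_def by (subst prod.lessThan_Suc_shift) simp
  then show ?case using Suc.IH by (simp add: mult.assoc del: mult_Suc)
qed (simp add: falling_def)

text \<open>Colourings are grouped by their partition into colour classes, and the partitions by
  their number of blocks. A partition with \<open>k\<close> blocks carries
  \<open>falling x k\<close> colourings.\<close>

lemma card_proper_colorings_eq_sum:
  assumes G: "pair_graph G"
  shows "card (proper_colorings G x) = (\<Sum>k\<le>card (pverts G). graph_stirling G k * falling x k)"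
proof -
  let ?V = "pverts G"
  note GD = pair_graphD[OF G]
  define S where "S = {P. partition_on ?V P \<and> (\<forall>A\<in>P. stable G A)}"
  have "S \<subseteq> Pow (Pow ?V)" by (auto simp: S_def partition_on_def)
  then have finS: "finite S" using GD(1) by (simp add: finite_subset)
  have fib: "{f \<in> proper_colorings G x. color_classes ?V f = P}
      = {f \<in> ?V \<rightarrow>\<^sub>E {..<x}. color_classes ?V f = P}" if "P \<in> S" for P
    using that by (auto simp: proper_colorings_eq_stable[OF GD(2)] S_def)
  have card_le: "card P \<le> card ?V" if "P \<in> S" for P
  proof (rule ccontr)
    assume "\<not> card P \<le> card ?V"
    then have "graph_stirling G (card P) = 0" by (intro graph_stirling_eq_0 GD(1)) auto
    moreover have "stable_partitions G (card P) \<subseteq> S" by (auto simp: stable_partitions_def S_def)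
    \<comment> \<open>A cardinality 0 could also mean an infinite set; finiteness of
      \<open>S\<close> excludes this.\<close>
    ultimately have "stable_partitions G (card P) = {}"
      using finS by (simp add: graph_stirling_def finite_subset)
    then show False using that by (auto simp: stable_partitions_def S_def)
  qed
  have "card (proper_colorings G x)
      = card (\<Union>P\<in>S. {f \<in> proper_colorings G x. color_classes ?V f = P})"
    by (rule arg_cong[of _ _ card])
       (auto simp: proper_colorings_eq_stable[OF GD(2)] S_def partition_on_color_classes)
  also have "\<dots> = (\<Sum>P\<in>S. card {f \<in> proper_colorings G x. color_classes ?V f = P})"
    by (rule card_UN_disjoint) (use finS finite_proper_colorings[OF GD(1)] in auto)
  also have "\<dots> = (\<Sum>P\<in>S. falling x (card P))"
  proof (rule sum.cong[OF refl])
    fix P assume P: "P \<in> S"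
    then have part: "partition_on ?V P" by (simp add: S_def)
    have "finite P" using GD(1) part by (rule finite_elements)
    then have "card {g \<in> P \<rightarrow>\<^sub>E {..<x}. inj_on g P} = falling x (card P)"
      by (simp add: card_inj_on_subset_funcset falling_def atLeast0LessThan)
    then show "card {f \<in> proper_colorings G x. color_classes ?V f = P} = falling x (card P)"
      by (simp add: fib[OF P] card_color_classes_eq[OF part])
  qed
  also have "\<dots> = (\<Sum>k\<le>card ?V. \<Sum>P | P \<in> S \<and> card P = k. falling x (card P))"
    by (rule sum.group[symmetric]) (use finS card_le in auto)
  also have "\<dots> = (\<Sum>k\<le>card ?V. graph_stirling G k * falling x k)"
    by (intro sum.cong refl) (simp add: graph_stirling_def stable_partitions_def S_def conj_assoc)
  finally show ?thesis .
qed

text \<open>Terms with \<open>x < k\<close> vanish, and shifting by \<open>k\<close> leaves the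
  series of 1/x!, with sum e. With the extra factor it becomes the series of (x + k)/x!, with sum e
  + k e.\<close>

lemma falling_sums: "(\<lambda>x. falling x k / fact x) sums exp (1::real)"
  and mult_falling_sums: "(\<lambda>x. x * falling x k / fact x) sums (exp (1::real) * (real k + 1))"
proof -
  have e: "(\<lambda>x. 1 / fact x) sums exp (1::real)"
    using exp_converges[of "1::real"] by (simp add: field_simps)
  have xe: "(\<lambda>x. real x / fact x) sums exp (1::real)"
  proof -
    have "real (Suc x) / fact (Suc x) = 1 / fact x" for x
      by (simp add: divide_simps)
    then have "(\<lambda>x. real (Suc x) / fact (Suc x)) sums exp 1" using e by (simp only:)
    then show ?thesis by (subst (asm) sums_Suc_iff) simp
  qed
  have shift: "falling (x + k) k / fact (x + k) = 1 / (fact x :: real)" for x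
  proof -
    have "real (falling (x + k) k) * fact x = fact (x + k)"
      using arg_cong[OF falling_add_mult_fact[of x k], of real] by simp
    then show ?thesis by (simp add: divide_simps)
  qed
  have "(\<lambda>x. falling (x + k) k / fact (x + k)) sums exp (1::real)"
    unfolding shift by (rule e)
  then show "(\<lambda>x. falling x k / fact x) sums exp (1::real)"
    by (subst (asm) sums_iff_shift) (simp add: falling_eq_0)
  have "(\<lambda>x. real x / fact x + real k * (1 / fact x)) sums (exp 1 + real k * exp 1)"
    by (intro sums_add sums_mult xe e)
  moreover have "(x + k) * falling (x + k) k / fact (x + k)
      = real x / fact x + real k * (1 / fact x)" for x
  proof -
    have "(x + k) * falling (x + k) k / fact (x + k)
        = real (x + k) * (falling (x + k) k / fact (x + k))" by simp
    then show ?thesis unfolding shift by (simp add: add_divide_distrib)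
  qed
  ultimately have "(\<lambda>x. (x + k) * falling (x + k) k / fact (x + k))
      sums (exp (1::real) * (real k + 1))"
    by (simp add: algebra_simps)
  then show "(\<lambda>x. x * falling x k / fact x) sums (exp (1::real) * (real k + 1))"
    by (subst (asm) sums_iff_shift) (simp add: falling_eq_0)
qed

lemma proper_colorings_sums_bell:
  assumes "pair_graph G"
  shows "(\<lambda>x. card (proper_colorings G x) / fact x) sums (exp (1::real) * graph_bell G)"
proof -
  have "(\<lambda>x. \<Sum>k\<le>card (pverts G). graph_stirling G k * (falling x k / fact x))
      sums (\<Sum>k\<le>card (pverts G). real (graph_stirling G k) * exp (1::real))"
    by (intro sums_sum sums_mult falling_sums)
  then show ?thesis
    by (simp add: card_proper_colorings_eq_sum[OF assms] graph_bell_def sum_divide_distrib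
        sum_distrib_left mult.commute)
qed

text \<open>The weight \<open>x - 1\<close> replaces \<open>exp 1 * (k + 1)\<close> by
  \<open>exp 1 * k\<close>, the contribution of a partition into \<open>k\<close> blocks. The
  subtraction is real, with weight -1 at \<open>x = 0\<close>.\<close>

lemma proper_colorings_sums_total:
  assumes "pair_graph G"
  shows "(\<lambda>x. (real x - 1) * card (proper_colorings G x) / fact x)
           sums (exp (1::real) * total_colors G)"
proof -
  have "(\<lambda>x. \<Sum>k\<le>card (pverts G).
        graph_stirling G k * (x * falling x k / fact x - falling x k / fact x))
      sums (\<Sum>k\<le>card (pverts G).
        real (graph_stirling G k) * (exp (1::real) * (real k + 1) - exp 1))"
    by (intro sums_sum sums_mult sums_diff falling_sums mult_falling_sums)
  then show ?thesis
    by (simp add: card_proper_colorings_eq_sum[OF assms] total_colors_def sum_divide_distrib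
        sum_distrib_left algebra_simps diff_divide_distrib sum_subtractf)
qed

subsection \<open>Poisson moments\<close>

text \<open>After the substitution x = k + 1, one of the p + 1 factors x cancels against x! and
  leaves this weight.\<close>

definition poisson_weight :: "nat \<Rightarrow> nat \<Rightarrow> real" where
  "poisson_weight p k = (real k + 1) ^ p / fact k"

text \<open>Equals e times the expectation of (X + 1)^p X^m for a Poisson variable X of mean
  1.\<close>

definition poisson_moment :: "nat \<Rightarrow> nat \<Rightarrow> real" where
  "poisson_moment p m = (\<Sum>k. poisson_weight p k * real k ^ m)"

text \<open>Shifting the index cancels one factor k + 1, and the binomial theorem expands the
  remaining (k + 1)^(m - 1) into powers below \<open>m\<close>.\<close>

lemma summable_power_div_fact: "summable (\<lambda>k. real k ^ m / fact k)"
proof (induction m rule: less_induct)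
  case (less m)
  show ?case
  proof (cases m)
    case 0
    then show ?thesis using summable_exp[of "1::real"] by (simp add: field_simps)
  next
    case (Suc l)
    have "real (Suc k) ^ m / fact (Suc k)
        = (\<Sum>i\<le>l. real (l choose i) * (real k ^ i / fact k))" for k
    proof -
      have "real (Suc k) ^ m / fact (Suc k) = (real k + 1) ^ l / fact k"
        using Suc by (simp add: divide_simps add.commute)
      also have "(real k + 1) ^ l = (\<Sum>i\<le>l. real (l choose i) * real k ^ i)"
        using binomial_ring[of "real k" 1 l] by simp
      finally show ?thesis by (simp add: sum_divide_distrib)
    qed
    moreover have "summable (\<lambda>k. \<Sum>i\<le>l. real (l choose i) * (real k ^ i / fact k))"
      using less Suc by (intro summable_sum summable_mult) auto
    ultimately have "summable (\<lambda>k. real (Suc k) ^ m / fact (Suc k))" by simp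
    then show ?thesis by (subst (asm) summable_Suc_iff)
  qed
qed

lemma poisson_moment_sums:
  "(\<lambda>k. poisson_weight p k * real k ^ m) sums poisson_moment p m"
proof -
  have "poisson_weight p k * real k ^ m
      = (\<Sum>i\<le>p. real (p choose i) * (real k ^ (i + m) / fact k))" for k
    using binomial_ring[of "real k" 1 p]
    by (simp add: poisson_weight_def sum_distrib_right sum_divide_distrib power_add mult.assoc)
  then have "summable (\<lambda>k. poisson_weight p k * real k ^ m)"
    by (simp only:) (intro summable_sum summable_mult summable_power_div_fact)
  then show ?thesis
    by (simp add: poisson_moment_def summable_sums)
qed

lemma poisson_weight_pos: "poisson_weight p k > 0"
  by (simp add: poisson_weight_def)

lemma poisson_moment_pos: "poisson_moment p m > 0"
  unfolding poisson_moment_def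
proof (rule suminf_pos2[where i = 1])
  show "summable (\<lambda>k. poisson_weight p k * real k ^ m)"
    using poisson_moment_sums by (rule sums_summable)
qed (simp_all add: poisson_weight_pos less_imp_le)

text \<open>Makes the denominator of the average for the triangle with a tail positive. For
  \<open>m > 0\<close> the terms at 0 and 1 agree, and \<open>k = 2\<close> is the first strict
  one.\<close>

lemma poisson_moment_strict_mono:
  assumes "m > 0"
  shows "poisson_moment p m < poisson_moment p (Suc m)"
proof -
  let ?f = "\<lambda>k. poisson_weight p k * real k ^ Suc m - poisson_weight p k * real k ^ m"
  have sums: "?f sums (poisson_moment p (Suc m) - poisson_moment p m)"
    by (intro sums_diff poisson_moment_sums)
  have "0 < (\<Sum>k. ?f k)"
  proof (rule suminf_pos2[where i = 2])
    show "summable ?f" using sums by (rule sums_summable)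
    show "0 \<le> ?f k" for k
    proof (cases "k = 0")
      case False
      then have "real k ^ m \<le> real k ^ Suc m" by (intro power_increasing) auto
      then show ?thesis
        by (simp add: mult_left_mono[OF _ less_imp_le[OF poisson_weight_pos]] del: power_Suc)
    qed (use assms in \<open>simp add: power_0_left\<close>)
  qed (simp add: poisson_weight_pos)
  then show ?thesis using sums_unique[OF sums] by simp
qed

section \<open>The symmetrized double sum\<close>

definition moment_kernel :: "nat \<Rightarrow> nat \<Rightarrow> nat \<Rightarrow> nat \<Rightarrow> real" where
  "moment_kernel p m i j = poisson_weight p i * poisson_weight p j * (real i * real j) ^ m
     * ((real i - real j)\<^sup>2 * (real i * real j - real i - real j))"

lemma moment_kernel_commute: "moment_kernel p m i j = moment_kernel p m j i"
  by (simp add: moment_kernel_def mult.commute power2_commute diff_diff_add add.commute)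

text \<open>The last factor of the kernel is (i - 1)(j - 1) - 1.\<close>

lemma moment_kernel_nonneg:
  assumes "2 \<le> i" "2 \<le> j"
  shows "0 \<le> moment_kernel p m i j"
proof -
  have "0 \<le> (real i - 1) * (real j - 1) - 1"
    using mult_mono[of 1 "real i - 1" 1 "real j - 1"] assms by simp
  then have "0 \<le> real i * real j - real i - real j"
    by (simp add: algebra_simps)
  then show ?thesis
    unfolding moment_kernel_def
    by (intro mult_nonneg_nonneg) (auto simp: less_imp_le poisson_weight_pos)
qed

text \<open>Without the common factor w_j j^m, the two terms are -w_1 (j - 1)^2 and w_2 2^m (j -
  2)^3. Since 2 w_1 <= w_2 2^m, it suffices that (j - 1)^2 < 2 (j - 2)^3, which holds from j = 4 on
  but fails at 3.\<close>

lemma moment_kernel_1_2: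
  assumes "4 \<le> j" "2 \<le> m"
  shows "0 < moment_kernel p m 1 j + moment_kernel p m 2 j"
proof -
  define y where "y = real j"
  have y: "4 \<le> y" using assms by (simp add: y_def)
  have w: "4 * poisson_weight p 1 \<le> poisson_weight p 2 * 2 ^ m * 2"
  proof -
    have "(2::real) ^ 2 \<le> 2 ^ m" using assms by (intro power_increasing) auto
    moreover have "(2::real) ^ p \<le> 3 ^ p" by (intro power_mono) auto
    ultimately have "2 ^ p * 4 \<le> (3::real) ^ p * 2 ^ m" by (intro mult_mono) auto
    then show ?thesis by (simp add: poisson_weight_def)
  qed
  have "(y - 1)\<^sup>2 < 2 * (y - 2) ^ 3"
  proof -
    \<comment> \<open>Expanded around 4, the difference has only positive coefficients.\<close>
    define z where "z = y - 4"
    have "0 \<le> z" using y by (simp add: z_def)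
    then have "0 < 2 * z ^ 3 + 11 * z\<^sup>2 + 18 * z + 7"
      by (intro add_nonneg_pos add_nonneg_nonneg) auto
    also have "\<dots> = 2 * (y - 2) ^ 3 - (y - 1)\<^sup>2"
      by (simp add: z_def power2_eq_square power3_eq_cube algebra_simps)
    finally show ?thesis by simp
  qed
  then have "poisson_weight p 1 * (y - 1)\<^sup>2 < poisson_weight p 1 * (2 * (y - 2) ^ 3)"
    using poisson_weight_pos by (rule mult_strict_left_mono)
  also have "\<dots> \<le> poisson_weight p 2 * 2 ^ m * (y - 2) ^ 3"
    using mult_right_mono[OF w, of "(y - 2) ^ 3"] y by (simp add: mult.commute)
  finally have *: "0 < poisson_weight p 2 * 2 ^ m * (y - 2) ^ 3 - poisson_weight p 1 * (y - 1)\<^sup>2"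
    by simp
  have "moment_kernel p m 1 j + moment_kernel p m 2 j
      = poisson_weight p j * y ^ m
        * (poisson_weight p 2 * 2 ^ m * (y - 2) ^ 3 - poisson_weight p 1 * (y - 1)\<^sup>2)"
    by (simp add: moment_kernel_def y_def[symmetric] power_mult_distrib)
       (simp add: power2_eq_square power3_eq_cube algebra_simps)
  then show ?thesis
    using * y by (simp add: poisson_weight_pos)
qed

lemma moment_kernel_0_left: "0 < m \<Longrightarrow> moment_kernel p m 0 j = 0"
  by (simp add: moment_kernel_def)

lemma moment_kernel_diag: "moment_kernel p m i i = 0"
  by (simp add: moment_kernel_def)

text \<open>
  For \<open>p = 0\<close>, \<open>m = 2\<close> this is an equality: \<open>3 + 5 = 2 + 6\<close>.
\<close>

lemma moment_kernel_small:
  assumes "2 \<le> m"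
  shows "0 \<le> moment_kernel p m 1 2 + moment_kernel p m 1 3
              + moment_kernel p m 2 3 + moment_kernel p m 3 4"
proof -
  define l where "l = m - 2"
  have m: "m = l + 2" using assms by (simp add: l_def)
  have e: "moment_kernel p m 1 2 = - 2 * (6 ^ p * 2 ^ l)"
       "moment_kernel p m 1 3 = - 6 * (8 ^ p * 3 ^ l)"
       "moment_kernel p m 2 3 = 3 * (12 ^ p * 6 ^ l)"
       "moment_kernel p m 3 4 = 5 * (20 ^ p * 12 ^ l)"
    by (simp_all add: moment_kernel_def poisson_weight_def m fact_numeral power_add
        flip: power_mult_distrib)
  \<comment> \<open>Writing A, B, C, D for the products in \<open>e\<close>, these bounds give 2A +
    6B <= 8B <= 3C + 5D.\<close>
  have "(6::real) ^ p * 2 ^ l \<le> 8 ^ p * 3 ^ l" "(8::real) ^ p * 3 ^ l \<le> 12 ^ p * 6 ^ l"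
     "(8::real) ^ p * 3 ^ l \<le> 20 ^ p * 12 ^ l"
    by (intro mult_mono power_mono; simp)+
  then show ?thesis unfolding e by linarith
qed

text \<open>The lower bound is positive and independent of \<open>N\<close>, so strictness survives
  the limit. Enlarging \<open>N\<close> adds a row and a column whose only negative entries, from
  the pair of 1 and N + 1, are outweighed by those from 2 and N + 1.\<close>

lemma moment_kernel_partial_sum:
  assumes "2 \<le> m" "4 \<le> N"
  shows "moment_kernel p m 1 4 + moment_kernel p m 2 4
           \<le> (\<Sum>i\<le>N. \<Sum>j\<le>N. moment_kernel p m i j) / 2"
  using assms(2)
proof (induction N rule: dec_induct)
  case base
  \<comment> \<open>Index 0 and the diagonal contribute nothing, and by symmetry each of the six
    remaining pairs occurs twice.\<close>
  have "(\<Sum>i\<le>4. \<Sum>j\<le>4. moment_kernel p m i j) / 2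
      = moment_kernel p m 1 2 + moment_kernel p m 1 3 + moment_kernel p m 1 4
        + moment_kernel p m 2 3 + moment_kernel p m 2 4 + moment_kernel p m 3 4"
    using moment_kernel_0_left[of m p] assms(1)
      moment_kernel_commute[of p m _ 0] moment_kernel_commute[of p m 2 1]
      moment_kernel_commute[of p m 3 1] moment_kernel_commute[of p m 4 1]
      moment_kernel_commute[of p m 3 2] moment_kernel_commute[of p m 4 2]
      moment_kernel_commute[of p m 4 3] moment_kernel_diag[of p m]
    by (simp add: numeral_eq_Suc)
  then show ?case using moment_kernel_small[OF assms(1), of p] by simp
next
  case (step N)
  have "0 \<le> (\<Sum>i\<le>N. moment_kernel p m i (Suc N))"
  proof -
    have "0 \<le> moment_kernel p m 1 (Suc N) + moment_kernel p m 2 (Suc N)"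
      using moment_kernel_1_2[of "Suc N" m p] step assms(1) by simp
    also have "\<dots> = (\<Sum>i\<in>{1, 2}. moment_kernel p m i (Suc N))" by simp
    also have "\<dots> \<le> (\<Sum>i\<le>N. moment_kernel p m i (Suc N))"
    proof (rule sum_mono2)
      fix i assume "i \<in> {..N} - {1, 2}"
      then have "i = 0 \<or> 2 \<le> i" by auto
      then show "0 \<le> moment_kernel p m i (Suc N)"
        using moment_kernel_nonneg[of i "Suc N" p m] step(1) assms(1)
        by (auto simp: moment_kernel_0_left)
    qed (use step(1) in auto)
    finally show ?thesis .
  qed
  moreover have "(\<Sum>i\<le>Suc N. \<Sum>j\<le>Suc N. moment_kernel p m i j)
      = (\<Sum>i\<le>N. \<Sum>j\<le>N. moment_kernel p m i j) + 2 * (\<Sum>i\<le>N. moment_kernel p m i (Suc N))"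
    by (simp add: sum.distrib moment_kernel_diag moment_kernel_commute[of p m "Suc N"])
  ultimately show ?case using step.IH by simp
qed

text \<open>Symmetrization takes place in truncated moments, where the order of summation can be
  exchanged freely; the limit comes last.\<close>

lemma poisson_moment_inequality:
  assumes "2 \<le> m"
  shows "poisson_moment p (m + 2) * (poisson_moment p (m + 2) - poisson_moment p (m + 1))
           < poisson_moment p (m + 3) * (poisson_moment p (m + 1) - poisson_moment p m)"
proof -
  define M where "M l N = (\<Sum>k\<le>N. poisson_weight p k * real k ^ l)" for l N
  define D where "D N = M (m + 3) N * (M (m + 1) N - M m N)
                     - M (m + 2) N * (M (m + 2) N - M (m + 1) N)" for N
  have "M l \<longlonglongrightarrow> poisson_moment p l" for l
    using poisson_moment_sums[of p l] unfolding M_def by (simp add: sums_def_le)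
  then have lim: "D \<longlonglongrightarrow> poisson_moment p (m + 3) * (poisson_moment p (m + 1) - poisson_moment p m)
      - poisson_moment p (m + 2) * (poisson_moment p (m + 2) - poisson_moment p (m + 1))"
    unfolding D_def by (intro tendsto_intros)
  have D: "D N = (\<Sum>i\<le>N. \<Sum>j\<le>N. moment_kernel p m i j) / 2" for N
  proof -
    define t where "t i j = poisson_weight p i * poisson_weight p j * (real i * real j) ^ m
        * ((real i)\<^sup>2 * (real j - 1) * (real i - real j))" for i j
    have D_t: "D N = (\<Sum>i\<le>N. \<Sum>j\<le>N. t i j)"
      unfolding D_def M_def sum_subtractf[symmetric] sum_product
    proof (intro sum.cong refl)
      fix i j
      show "poisson_weight p i * real i ^ (m + 3)
              * (poisson_weight p j * real j ^ (m + 1) - poisson_weight p j * real j ^ m)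
          - poisson_weight p i * real i ^ (m + 2)
              * (poisson_weight p j * real j ^ (m + 2) - poisson_weight p j * real j ^ (m + 1)) = t i j"
        by (simp add: t_def power_add power_mult_distrib power2_eq_square power3_eq_cube algebra_simps)
    qed
    have D_t': "D N = (\<Sum>i\<le>N. \<Sum>j\<le>N. t j i)"
      unfolding D_t by (rule sum.swap)
    \<comment> \<open>Here i^2 (j - 1) - j^2 (i - 1) = (i - j)(ij - i - j), which gives the second
      factor i - j.\<close>
    have "t i j + t j i = moment_kernel p m i j" for i j
      unfolding t_def moment_kernel_def by (simp add: power2_eq_square algebra_simps)
    then have "(\<Sum>i\<le>N. \<Sum>j\<le>N. moment_kernel p m i j) = (\<Sum>i\<le>N. \<Sum>j\<le>N. t i j + t j i)"
      by simp
    also have "\<dots> = D N + D N"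
      unfolding sum.distrib using D_t D_t' by simp
    finally show ?thesis by simp
  qed
  have "moment_kernel p m 1 4 + moment_kernel p m 2 4
      \<le> poisson_moment p (m + 3) * (poisson_moment p (m + 1) - poisson_moment p m)
      - poisson_moment p (m + 2) * (poisson_moment p (m + 2) - poisson_moment p (m + 1))"
    using moment_kernel_partial_sum[OF assms, of _ p]
    by (intro LIMSEQ_le_const[OF lim]) (auto simp: D)
  then show ?thesis using moment_kernel_1_2[of 4 m p] assms by simp
qed

subsection \<open>Comparison of the two graphs\<close>

text \<open>Re-indexes both series by x = k + 1. The term at x = 0 drops out because there is no
  colouring with 0 colours, and the weight x - 1 becomes \<open>k\<close>.\<close>

lemma poisson_weight_sums:
  assumes G: "pair_graph G" and c0: "card (proper_colorings G 0) = 0"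
    and c: "\<And>k. real (card (proper_colorings G (Suc k))) = (real k + 1) ^ Suc p * g k"
  shows "(\<lambda>k. poisson_weight p k * g k) sums (exp 1 * graph_bell G)"
    and "(\<lambda>k. poisson_weight p k * (real k * g k)) sums (exp 1 * total_colors G)"
proof -
  have w: "real (card (proper_colorings G (Suc k))) / fact (Suc k) = poisson_weight p k * g k" for k
    unfolding c by (simp add: poisson_weight_def divide_simps)
  have "(\<lambda>k. card (proper_colorings G (Suc k)) / fact (Suc k)) sums (exp (1::real) * graph_bell G)"
    using proper_colorings_sums_bell[OF G] by (subst sums_Suc_iff) (simp add: c0)
  then show "(\<lambda>k. poisson_weight p k * g k) sums (exp 1 * graph_bell G)"
    unfolding w .
  have w': "(real (Suc k) - 1) * real (card (proper_colorings G (Suc k))) / fact (Suc k)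
      = poisson_weight p k * (real k * g k)" for k
  proof -
    have "(real (Suc k) - 1) * real (card (proper_colorings G (Suc k))) / fact (Suc k)
        = real k * (real (card (proper_colorings G (Suc k))) / fact (Suc k))" by simp
    then show ?thesis unfolding w by (simp only: mult.left_commute)
  qed
  have "(\<lambda>k. (real (Suc k) - 1) * card (proper_colorings G (Suc k)) / fact (Suc k))
      sums (exp (1::real) * total_colors G)"
    using proper_colorings_sums_total[OF G] by (subst sums_Suc_iff) (simp add: c0)
  then show "(\<lambda>k. poisson_weight p k * (real k * g k)) sums (exp 1 * total_colors G)"
    unfolding w' .
qed

lemma path_graph_poisson_moment:
  shows "exp 1 * real (graph_bell (add_isolated (path_graph (Suc n)) p)) = poisson_moment p n"
    and "exp 1 * real (total_colors (add_isolated (path_graph (Suc n)) p)) = poisson_moment p (n + 1)"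
proof -
  let ?G = "add_isolated (path_graph (Suc n)) p"
  have G: "pair_graph ?G" by (intro pair_graph_add_isolated pair_graph_path_graph)
  have c0: "card (proper_colorings ?G 0) = 0"
    unfolding card_proper_colorings_add_isolated card_proper_colorings_path_graph by simp
  have c: "real (card (proper_colorings ?G (Suc k))) = (real k + 1) ^ Suc p * real k ^ n" for k
    unfolding card_proper_colorings_add_isolated card_proper_colorings_path_graph
    by (simp add: algebra_simps)
  note sums = poisson_weight_sums[OF G c0 c]
  show "exp 1 * real (graph_bell ?G) = poisson_moment p n"
    using sums(1) poisson_moment_sums by (rule sums_unique2)
  show "exp 1 * real (total_colors ?G) = poisson_moment p (n + 1)"
    using sums(2) poisson_moment_sums[of p "n + 1"] by (simp add: sums_unique2)
qed

lemma H_graph_3_poisson_moment: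
  shows "exp 1 * real (graph_bell (add_isolated (H_graph 3 r) p))
           = poisson_moment p (r + 2) - poisson_moment p (r + 1)"
    and "exp 1 * real (total_colors (add_isolated (H_graph 3 r) p))
           = poisson_moment p (r + 3) - poisson_moment p (r + 2)"
proof -
  let ?G = "add_isolated (H_graph 3 r) p"
  have G: "pair_graph ?G" by (intro pair_graph_add_isolated pair_graph_H_graph) simp
  have c0: "card (proper_colorings ?G 0) = 0"
    unfolding card_proper_colorings_add_isolated card_proper_colorings_H_graph_3 by simp
  have c: "real (card (proper_colorings ?G (Suc k)))
      = (real k + 1) ^ Suc p * (real k ^ (r + 2) - real k ^ (r + 1))" for k
    unfolding card_proper_colorings_add_isolated card_proper_colorings_H_graph_3
    \<comment> \<open>At \<open>k = 0\<close> the natural number x - 2 is truncated, but the factor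
      x - 1 is 0 and both powers of \<open>k\<close> vanish.\<close>
    by (cases k) (simp_all add: algebra_simps)
  note sums = poisson_weight_sums[OF G c0 c]
  have diff: "(\<lambda>k. poisson_weight p k * (real k ^ Suc l - real k ^ l))
      sums (poisson_moment p (Suc l) - poisson_moment p l)" for l
    using sums_diff[OF poisson_moment_sums[of p "Suc l"] poisson_moment_sums[of p l]]
    by (simp only: right_diff_distrib)
  show "exp 1 * real (graph_bell ?G) = poisson_moment p (r + 2) - poisson_moment p (r + 1)"
    using sums(1) diff[of "r + 1"] by (simp add: sums_unique2)
  have "real k * (real k ^ (r + 2) - real k ^ (r + 1)) = real k ^ Suc (r + 2) - real k ^ (r + 2)" for k
    by (simp add: right_diff_distrib)
  then show "exp 1 * real (total_colors ?G) = poisson_moment p (r + 3) - poisson_moment p (r + 2)"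
    using sums_unique2[OF sums(2)] diff[of "r + 2"]
    by (simp only: add_Suc_right numeral_3_eq_3 numeral_2_eq_2)
qed

theorem theorem11:
  fixes n p :: nat
  assumes "n \<ge> 4"
  shows "avg_colors (add_isolated (H_graph 3 (n - 3)) p)
           < avg_colors (add_isolated (path_graph (n + 1)) p)"
proof -
  define r where "r = n - 3"
  have n: "n = r + 3" "1 \<le> r" using assms by (simp_all add: r_def)
  \<comment> \<open>Expanding the fraction by e exposes the moments in numerator and
    denominator.\<close>
  have avg: "avg_colors G = exp 1 * total_colors G / (exp 1 * graph_bell G)"
    for G :: "'b pair_pre_digraph"
    by (simp add: avg_colors_def)
  have H: "avg_colors (add_isolated (H_graph 3 r) p)
      = (poisson_moment p (r + 3) - poisson_moment p (r + 2))
        / (poisson_moment p (r + 2) - poisson_moment p (r + 1))"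
    unfolding avg H_graph_3_poisson_moment ..
  have P: "avg_colors (add_isolated (path_graph (n + 1)) p)
      = poisson_moment p (r + 4) / poisson_moment p (r + 3)"
    unfolding avg Suc_eq_plus1[symmetric] path_graph_poisson_moment by (simp add: n(1) add.commute)
  have "0 < poisson_moment p (r + 2) - poisson_moment p (r + 1)"
    using poisson_moment_strict_mono[of "r + 1" p] by simp
  \<comment> \<open>The moment inequality is used at m = r + 1; its condition m >= 2 is exactly n >=
    4.\<close>
  moreover have "poisson_moment p (r + 3) * (poisson_moment p (r + 3) - poisson_moment p (r + 2))
      < poisson_moment p (r + 4) * (poisson_moment p (r + 2) - poisson_moment p (r + 1))"
    using poisson_moment_inequality[of "r + 1" p] n(2) by (simp add: add.assoc numeral_eq_Suc)
  ultimately show ?thesis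
    unfolding r_def[symmetric] H P
    by (simp add: poisson_moment_pos pos_divide_less_eq less_divide_eq mult.commute)
qed

end
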